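(* The two identities $$x(x'x) = x$$ and $$x\,(x'\,(y\,(y'\,((z\,u)'\,w')'))) = y\,(y'\,(x\,(x'\,((w\,z)\,u))))$$ form a $2$-base for inverse semigroups. That is: (i) an algebra $(S,\cdot,{}')$ of type $\langle 2,1\rangle$ (a set $S$ with a binary operation $\cdot$, not assumed associative, and a unary operation ${}'$) satisfies both identities for all $x,y,z,u,w\in S$ if and only if $(S,\cdot)$ is an inverse semigroup and, for each $a\in S$, $a'$ is the unique inverse of $a$ in $(S,\cdot)$; and (ii) the two identities are independent, i.e. neither one holds in every algebra of type $\langle 2,1\rangle$ satisfying the other.
   Context: The binary operation is written as juxtaposition, and ${}'$ denotes the unary operation. In a semigroup, an element $b$ is an inverse of an element $a$ if $aba=a$ and $bab=b$. A semigroup is an inverse semigroup if every element has exactly one inverse; the natural inversion is the unary operation sending each element to its unique inverse. In the language of algebras of type $\langle 2,1\rangle$, an $n$-base for inverse semigroups is a set of $n$ independent identities which defines the variety of inverse semigroups, with the binary operation being the semigroup multiplication and the unary operation coinciding with the natural inversion. *)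

theory Defs
  imports Main
begin

text \<open>
  Algebras are given by a carrier set in an arbitrary type, so that finite and infinite
  algebras are treated alike; all operations are relevant on the carrier only.
  The carrier may be empty.

  Independence of identities is expressed by separating algebras on sets of naturals. This is no
  restriction: an algebra violating an identity has a finitely generated, hence countable,
  subalgebra violating it.
\<close>

definition algebra_2_1 :: "'a set \<Rightarrow> ('a \<Rightarrow> 'a \<Rightarrow> 'a) \<Rightarrow> ('a \<Rightarrow> 'a) \<Rightarrow> bool" where
  "algebra_2_1 S f g \<longleftrightarrow> (\<forall>x\<in>S. \<forall>y\<in>S. f x y \<in> S) \<and> (\<forall>x\<in>S. g x \<in> S)"

context
  fixes S :: "'a set"
    and mult :: "'a \<Rightarrow> 'a \<Rightarrow> 'a"  (infixl "\<cdot>" 70)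
begin

definition semigroup_on :: bool where
  "semigroup_on \<longleftrightarrow>
     (\<forall>x\<in>S. \<forall>y\<in>S. x \<cdot> y \<in> S) \<and>
     (\<forall>x\<in>S. \<forall>y\<in>S. \<forall>z\<in>S. (x \<cdot> y) \<cdot> z = x \<cdot> (y \<cdot> z))"

definition is_inverse_of :: "'a \<Rightarrow> 'a \<Rightarrow> bool" where
  "is_inverse_of b a \<longleftrightarrow> b \<in> S \<and> (a \<cdot> b) \<cdot> a = a \<and> (b \<cdot> a) \<cdot> b = b"

definition inverse_semigroup_on :: bool where
  "inverse_semigroup_on \<longleftrightarrow> semigroup_on \<and> (\<forall>a\<in>S. \<exists>!b. is_inverse_of b a)"

definition natural_inversion :: "('a \<Rightarrow> 'a) \<Rightarrow> bool" where
  "natural_inversion g \<longleftrightarrow>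
     (\<forall>a\<in>S. is_inverse_of (g a) a \<and> (\<forall>b. is_inverse_of b a \<longrightarrow> b = g a))"

context
  fixes inv :: "'a \<Rightarrow> 'a"  ("_\<acute>" [1000] 1000)
begin

definition identity1 :: bool where
  "identity1 \<longleftrightarrow> (\<forall>x\<in>S. x \<cdot> (x\<acute> \<cdot> x) = x)"

definition identity2 :: bool where
  "identity2 \<longleftrightarrow> (\<forall>x\<in>S. \<forall>y\<in>S. \<forall>z\<in>S. \<forall>u\<in>S. \<forall>w\<in>S.
     x \<cdot> (x\<acute> \<cdot> (y \<cdot> (y\<acute> \<cdot> ((z \<cdot> u)\<acute> \<cdot> w\<acute>)\<acute>))) =
     y \<cdot> (y\<acute> \<cdot> (x \<cdot> (x\<acute> \<cdot> ((w \<cdot> z) \<cdot> u)))))"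

end

end

end

theory Submission
  imports Defs
begin

text \<open>
  Write L_x t = x (x' t), so that L_x x = x. For t = (w z) u and r = ((z u)' w')' the second identity
  says L_x L_y r = L_y L_x t, and the choices x, y \<in> {r, t} force r = t. Hence the dual
  multiplication x * y = (y' x')' satisfies x * (y z) = (x y) z, and all L_x commute.
  It follows that the unary operation is injective and surjective, next that x' (x x') = x' and
  x'' = x, and finally that x * y = x y, which turns the mixed law into associativity.
  Commutation of the L_x then says that the idempotents x x' commute.

  The equational reasoning is done for total operations. It applies to an algebra on a proper
  subset S because S embeds in an algebra on the whole type: the elements outside S are made
  pairwise orthogonal idempotents, orthogonal also to S, with one of them as zero. This changes
  neither the validity of the two identities nor being an inverse semigroup.
\<close>

section \<open>From the two identities to associativity and unique inverses\<close>

locale two_identities =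
  fixes mult :: "'a \<Rightarrow> 'a \<Rightarrow> 'a"  (infixl "\<cdot>" 70)
    and inv :: "'a \<Rightarrow> 'a"  ("_\<acute>" [1000] 1000)
  assumes id1: "x \<cdot> (x\<acute> \<cdot> x) = x"
    and id2: "x \<cdot> (x\<acute> \<cdot> (y \<cdot> (y\<acute> \<cdot> ((z \<cdot> u)\<acute> \<cdot> w\<acute>)\<acute>))) =
              y \<cdot> (y\<acute> \<cdot> (x \<cdot> (x\<acute> \<cdot> ((w \<cdot> z) \<cdot> u))))"
begin

lemma mult_assoc_dual: "((z \<cdot> u)\<acute> \<cdot> w\<acute>)\<acute> = (w \<cdot> z) \<cdot> u"
proof -
  define L where "L x t = x \<cdot> (x\<acute> \<cdot> t)" for x t
  define t where "t = (w \<cdot> z) \<cdot> u"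
  define r where "r = ((z \<cdot> u)\<acute> \<cdot> w\<acute>)\<acute>"
  have L_self: "L x x = x" for x
    unfolding L_def by (rule id1)
  have L_r: "L x (L y r) = L y (L x t)" for x y
    unfolding L_def r_def t_def by (rule id2)
  have "L t r = L r t"
    using L_r[of t r] by (simp add: L_self)
  then have "L t (L r t) = t"
    using L_r[of t t] by (simp add: L_self)
  moreover have "L r (L r t) = L r (L t r)"
    using \<open>L t r = L r t\<close> by simp
  \<comment> \<open>The choice x = y = r gives L_r (L_r t) = r, while x = r, y = t gives L_r (L_t r)
    = L_t (L_r t) = t.\<close>
  ultimately have "r = t"
    by (metis L_r L_self)
  then show ?thesis
    by (simp add: r_def t_def)
qed

text \<open>By \<open>mult_assoc_dual\<close> the inner terms of \<open>id2\<close> agree, and (w z)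
  u ranges over all elements because z = (z (z' z)) (z' z).\<close>

lemma left_mult_commute:
  "x \<cdot> (x\<acute> \<cdot> (y \<cdot> (y\<acute> \<cdot> z))) = y \<cdot> (y\<acute> \<cdot> (x \<cdot> (x\<acute> \<cdot> z)))"
proof -
  have "z = (z \<cdot> (z\<acute> \<cdot> z)) \<cdot> (z\<acute> \<cdot> z)"
    by (simp add: id1)
  then show ?thesis
    using id2[of x y "z\<acute> \<cdot> z" "z\<acute> \<cdot> z" z] by (simp add: mult_assoc_dual)
qed

lemma dual_mult: "(y\<acute> \<cdot> x\<acute>)\<acute> = (x \<cdot> y) \<cdot> (y\<acute> \<cdot> y)"
  using mult_assoc_dual[of y "y\<acute> \<cdot> y" x] by (simp add: id1)

text \<open>This is the first identity for the dual multiplication: x * (x' * x) = x * ((x' x) (x'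
  x)) = (x (x' x)) (x' x) = x.\<close>

lemma dual_id1: "((x\<acute> \<cdot> x\<acute>\<acute>)\<acute>\<acute> \<cdot> x\<acute>)\<acute> = x"
  by (metis dual_mult id1 mult_assoc_dual)

text \<open>\<open>dual_id1\<close> writes x as a term in x' alone.\<close>

lemma inv_eq_iff: "x\<acute> = y\<acute> \<longleftrightarrow> x = y"
  by (metis dual_id1)

lemma inv_mult_inv_left: "x\<acute> \<cdot> (x \<cdot> x\<acute>) = x\<acute>"
proof -
  \<comment> \<open>s is the inverse function of the unary operation; the goal amounts to q x = x.\<close>
  define s where "s x = ((x \<cdot> x\<acute>)\<acute>\<acute> \<cdot> x)\<acute>" for x
  have s': "s (x\<acute>) = x" for x
    unfolding s_def by (rule dual_id1)
  \<comment> \<open>\<open>dual_id1\<close> also exhibits x as a value of the unary operation, so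
    \<open>s\<close> inverts it on both sides.\<close>
  have s: "(s x)\<acute> = x" for x
    by (metis s' dual_id1)
  define q where "q x = x \<cdot> (s x \<cdot> x)" for x
  have s_id1: "s x \<cdot> (x \<cdot> s x) = s x" for x
    using id1[of "s x"] by (simp add: s)
  have q_inv: "q (x\<acute>) = x\<acute> \<cdot> (x \<cdot> x\<acute>)" for x
    by (simp add: q_def s')
  have q_mult: "q x \<cdot> s x = x \<cdot> s x" for x
    by (metis q_def s mult_assoc_dual dual_mult id1)
  have step1: "(x \<cdot> x\<acute>)\<acute>\<acute> \<cdot> x = s (s x)" for x
    by (metis s s' dual_id1)
  \<comment> \<open>\<open>dual_mult\<close> sees \<open>q x\<close> only through
    \<open>q x \<cdot> s x\<close>, which is \<open>x \<cdot> s x\<close>; injectivity removes the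
    outer inverse.\<close>
  have step2: "x \<cdot> (q x)\<acute> = x \<cdot> x\<acute>" for x
  proof -
    have "(x \<cdot> (q x)\<acute>)\<acute> = (x \<cdot> x\<acute>)\<acute>"
      using dual_mult[of "s x" "q x"] dual_mult[of "s x" x] by (simp add: s q_mult)
    then show ?thesis
      by (simp add: inv_eq_iff)
  qed
  \<comment> \<open>Since (w z) u = w * (z u), an equation z u = y v lifts to (w z) u = (w y) v. The
    same lifting gives \<open>step6\<close>, \<open>step11\<close> and
    \<open>step13\<close>.\<close>
  have step3: "s (s x) \<cdot> (q x)\<acute> = s (s x) \<cdot> x\<acute>" for x
    by (metis step2 mult_assoc_dual step1)
  have step4: "x \<cdot> y \<cdot> (s y \<cdot> y) \<cdot> s y = (y\<acute> \<cdot> x\<acute>)\<acute> \<cdot> s y" for x y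
  proof -
    have "((q y)\<acute> \<cdot> x\<acute>)\<acute> \<cdot> s y = (y\<acute> \<cdot> x\<acute>)\<acute> \<cdot> s y"
      by (metis step3 mult_assoc_dual s inv_eq_iff)
    then show ?thesis
      by (simp add: q_def mult_assoc_dual)
  qed
  have step5: "x \<cdot> (y \<cdot> x \<cdot> (s x \<cdot> x))\<acute> = x \<cdot> (x\<acute> \<cdot> y\<acute>)\<acute>\<acute>" for x y
    by (metis step4 dual_mult inv_eq_iff s)
  have step6: "z \<cdot> q x \<cdot> s x = z \<cdot> x \<cdot> s x" for x z
    by (metis mult_assoc_dual q_mult)
  have step7: "x \<cdot> (z \<cdot> q x)\<acute> = x \<cdot> (z \<cdot> x)\<acute>" for x z
    by (metis step6 dual_mult inv_eq_iff s)
  have step8: "x \<cdot> (y \<cdot> s y \<cdot> z)\<acute> \<cdot> y = ((z \<cdot> x\<acute>)\<acute> \<cdot> y)\<acute>\<acute>" for x y z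
    by (metis id1 s mult_assoc_dual)
  have step9: "x \<cdot> (y \<cdot> y\<acute>)\<acute>\<acute> \<cdot> y = (s y \<cdot> x\<acute>)\<acute>" for x y
    by (metis step1 s mult_assoc_dual)
  have step10: "q x \<cdot> x\<acute> = x \<cdot> x\<acute>" for x
  proof -
    have "((s x \<cdot> x \<cdot> x\<acute>)\<acute> \<cdot> x\<acute>)\<acute>\<acute> = x \<cdot> (x\<acute> \<cdot> x \<cdot> (s x \<cdot> x))\<acute> \<cdot> x\<acute>"
      using step8[of x "x\<acute>" "s x \<cdot> x"] by (simp add: s')
    also have "\<dots> = (x \<cdot> x\<acute>)\<acute>"
      using step9[of x "x\<acute>"] by (simp add: step5 s')
    finally show ?thesis
      by (simp add: inv_eq_iff q_def mult_assoc_dual)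
  qed
  have step11: "x \<cdot> (y \<cdot> z) \<cdot> (q z)\<acute> = x \<cdot> (y \<cdot> z) \<cdot> z\<acute>" for x y z
    by (metis step2 mult_assoc_dual)
  have step12: "x \<cdot> y \<cdot> s (q y) = x \<cdot> y \<cdot> s y" for x y
  proof -
    have qq: "q y \<cdot> (q y)\<acute> = y \<cdot> y\<acute>"
      using step11[of y "s y" y] by (simp add: q_def[symmetric] step10)
    \<comment> \<open>Unfolding leaves \<open>q y\<close> in two places: in the product
      \<open>q y \<cdot> (q y)\<acute>\<close>, equal to y y' by \<open>qq\<close>, and as a last
      factor, which \<open>step7\<close> turns into y.\<close>
    have "s (q y) = (s (s (q y)))\<acute>"
      by (simp add: s)
    also have "\<dots> = ((y \<cdot> y\<acute>)\<acute>\<acute> \<cdot> q y)\<acute>"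
      by (simp add: step1[symmetric] qq)
    finally have "x \<cdot> y \<cdot> s (q y) = x \<cdot> y \<cdot> ((y \<cdot> y\<acute>)\<acute>\<acute> \<cdot> q y)\<acute>"
      by simp
    also have "\<dots> = x \<cdot> y \<cdot> ((y \<cdot> y\<acute>)\<acute>\<acute> \<cdot> y)\<acute>"
      by (metis step7 mult_assoc_dual)
    finally show ?thesis
      by (simp add: step1 s)
  qed
  have step13: "x \<cdot> (y \<cdot> z) \<cdot> s (q z) = x \<cdot> (y \<cdot> z) \<cdot> s z" for x y z
    by (metis step12 mult_assoc_dual)
  have step14: "x \<cdot> s (q x) = x \<cdot> s x" for x
  proof -
    \<comment> \<open>So x y can be recovered from (x' x) y, and the left factor x' cancels from
      \<open>step12\<close>.\<close>
    have "(x\<acute> \<cdot> x \<cdot> y)\<acute> \<cdot> x\<acute> = s (x \<cdot> y)" for y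
      by (metis s' mult_assoc_dual id1)
    with step12[of "x\<acute>" x] show ?thesis
      by (metis s)
  qed
  have step15: "s (q x) \<cdot> (x \<cdot> s x) = s x" for x
  proof -
    \<comment> \<open>This is L_a (L_b a) = L_b (L_a a) = L_b a for a = s (q x) and b = s x. With
      \<open>step14\<close> the sides become s (q x) (x s x) and s x.\<close>
    have "s (q x) \<cdot> (q x \<cdot> (s x \<cdot> (x \<cdot> s (q x)))) = s x \<cdot> (x \<cdot> s (q x))"
      using left_mult_commute[of "s (q x)" "s x" "s (q x)"] s_id1[of "q x"] by (simp add: s)
    then show ?thesis
      by (simp add: step14 s_id1 q_mult)
  qed
  have "s (q x) = s x" for x
    using s_id1[of "q x"] step15[of x] step13[of x "s x" x]
    by (simp add: q_def[symmetric] q_mult)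
  then have "q x = x" for x
    by (metis s)
  then show ?thesis
    using q_inv by simp
qed

lemma mult_inv_eq: "x \<cdot> x\<acute> = x\<acute>\<acute> \<cdot> x\<acute>"
proof -
  have step1: "x \<cdot> (y \<cdot> z) \<cdot> (z\<acute> \<cdot> z) = ((z\<acute> \<cdot> y\<acute>)\<acute>\<acute> \<cdot> x\<acute>)\<acute>" for x y z
    by (metis mult_assoc_dual dual_mult)
  have step2: "(x \<cdot> y\<acute>) \<cdot> (y \<cdot> y\<acute>) = (y\<acute>\<acute> \<cdot> x\<acute>)\<acute>" for x y
    by (metis mult_assoc_dual inv_mult_inv_left)
  have step3: "((x \<cdot> x\<acute>)\<acute>\<acute> \<cdot> x)\<acute> = (x\<acute> \<cdot> x\<acute>\<acute>)\<acute>\<acute> \<cdot> x\<acute>" for x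
    by (metis dual_id1)
  have step4: "((x\<acute> \<cdot> x)\<acute>\<acute> \<cdot> x\<acute>)\<acute> = x" for x
    by (metis step1 step3 inv_mult_inv_left id1 dual_id1)
  have step5: "(x \<cdot> y) \<cdot> (((y\<acute> \<cdot> y)\<acute>\<acute> \<cdot> y\<acute>) \<cdot> y) = (y\<acute> \<cdot> x\<acute>)\<acute>" for x y
    by (metis step2 step4)
  have step6: "((x\<acute> \<cdot> x)\<acute>\<acute> \<cdot> (y \<cdot> x)\<acute>)\<acute> = (x\<acute> \<cdot> y\<acute>)\<acute> \<cdot> (x\<acute> \<cdot> x)" for x y
    by (metis step1 step5 step4)
  have step7: "x \<cdot> (y \<cdot> z\<acute>) \<cdot> (z \<cdot> z\<acute>) = ((z\<acute>\<acute> \<cdot> y\<acute>)\<acute>\<acute> \<cdot> x\<acute>)\<acute>" for x y z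
    by (metis mult_assoc_dual step2)
  have step8: "(x\<acute>\<acute> \<cdot> y\<acute>)\<acute> \<cdot> (x\<acute>\<acute> \<cdot> x\<acute>) = (x\<acute>\<acute> \<cdot> y\<acute>)\<acute> \<cdot> (x \<cdot> x\<acute>)" for x y
    by (metis step7 step2 step6)
  \<comment> \<open>Put e = x'' x'. Then x x' = L_x e, so L_e (x x') = L_x (L_e e) = x x'. On the
    other hand \<open>step8\<close> with y = x gives L_e (x x') = L_e e = e.\<close>
  have "(x\<acute>\<acute> \<cdot> x\<acute>) \<cdot> ((x\<acute>\<acute> \<cdot> x\<acute>)\<acute> \<cdot> (x \<cdot> x\<acute>)) = x \<cdot> x\<acute>"
    by (metis left_mult_commute id1)
  then show ?thesis
    by (metis step8 id1)
qed

lemma inv_inv: "x\<acute>\<acute> = x"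
proof -
  have step1: "((x\<acute> \<cdot> x\<acute>\<acute>)\<acute>\<acute> \<cdot> x\<acute>) \<cdot> x = x\<acute> \<cdot> x" for x
    by (metis mult_inv_eq dual_id1)
  have step2: "(x\<acute> \<cdot> x\<acute>\<acute>)\<acute> = (x\<acute> \<cdot> x)\<acute>" for x
    by (metis dual_mult step1 dual_id1)
  have step3: "x \<cdot> y\<acute> \<cdot> y\<acute>\<acute> = x \<cdot> y\<acute> \<cdot> y" for x y
    by (metis mult_assoc_dual step2)
  have step4: "x\<acute> \<cdot> x\<acute>\<acute> = x\<acute> \<cdot> x" for x
    by (metis step2 inv_eq_iff)
  have step5: "x\<acute>\<acute> \<cdot> (x\<acute> \<cdot> x) = x\<acute>\<acute>" for x
    by (metis inv_mult_inv_left step4)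
  have step6: "x \<cdot> (y \<cdot> z\<acute>) \<cdot> z\<acute>\<acute> = x \<cdot> (y \<cdot> z\<acute>) \<cdot> z" for x y z
    by (metis mult_assoc_dual step3)
  have step7: "x\<acute>\<acute>\<acute> \<cdot> x = x\<acute> \<cdot> x" for x
    by (metis step6 step5 mult_inv_eq step4)
  \<comment> \<open>Take y = x'': here L_y x = x'' by \<open>step7\<close> and \<open>step5\<close>,
    so L_x x'' = x''. But L_x x'' = x by \<open>step4\<close>.\<close>
  have "x \<cdot> (x\<acute> \<cdot> (y \<cdot> (y\<acute> \<cdot> x))) = y \<cdot> (y\<acute> \<cdot> x)" for x y
    by (metis left_mult_commute id1)
  then show ?thesis
    by (metis step4 id1 step7 step5)
qed

lemma mult_inv_mult: "(x \<cdot> x\<acute>) \<cdot> x = x"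
  by (metis dual_id1 inv_inv)

lemma inv_mult_inv: "(x \<cdot> x\<acute>)\<acute> = x \<cdot> x\<acute>"
  by (metis mult_inv_mult mult_assoc_dual inv_inv)

text \<open>With inversion an involution, the mixed law becomes \<open>step1\<close>. The aim is
  \<open>step10\<close>, the same law with the other bracketing; it suffices because every right
  factor y is a product y (y' y).\<close>

lemma inv_mult: "(x \<cdot> y)\<acute> = y\<acute> \<cdot> x\<acute>"
proof -
  have step1: "(x \<cdot> y \<cdot> z)\<acute> = (y \<cdot> z)\<acute> \<cdot> x\<acute>" for x y z
    by (metis mult_assoc_dual inv_inv)
  have step2: "x \<cdot> (y \<cdot> y\<acute>) \<cdot> y = (y\<acute> \<cdot> x\<acute>)\<acute>" for x y
    by (metis mult_assoc_dual mult_inv_mult)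
  have step3: "(x \<cdot> y)\<acute> \<cdot> (x \<cdot> x\<acute>) = (x \<cdot> y)\<acute>" for x y
    by (metis step1 mult_inv_mult inv_mult_inv)
  have step4: "(x\<acute> \<cdot> x)\<acute> = x\<acute> \<cdot> x" for x
    using inv_mult_inv[of "x\<acute>"] by (simp add: inv_inv)
  have step5: "(x \<cdot> y)\<acute> \<cdot> x = y\<acute> \<cdot> x\<acute> \<cdot> x" for x y
    using mult_assoc_dual[of "x\<acute>" x "y\<acute>"] step1[of "x\<acute>" x y] by (simp add: step4 inv_inv)
  have step6: "(x\<acute> \<cdot> (x \<cdot> y))\<acute> = y\<acute> \<cdot> x\<acute> \<cdot> x" for x y
    by (metis step2 step3 step5 inv_inv)
  have step7: "x\<acute> \<cdot> y\<acute> \<cdot> y \<cdot> y\<acute> = (y \<cdot> x)\<acute>" for x y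
    by (metis step1 id1 inv_inv step5)
  have step8: "x\<acute> \<cdot> x \<cdot> y = x\<acute> \<cdot> (x \<cdot> y)" for x y
    by (metis step6 inv_inv step1 inv_mult_inv)
  have step9: "x \<cdot> (x\<acute> \<cdot> (x \<cdot> y)) = x \<cdot> y" for x y
    by (metis dual_mult step7 inv_inv step3 step1 inv_mult_inv step8)
  have step10: "(x \<cdot> (y \<cdot> z))\<acute> = (y \<cdot> z)\<acute> \<cdot> x\<acute>" for x y z
    by (metis step1 step9 inv_inv step7)
  show ?thesis
    by (metis step10 inv_mult_inv_left inv_inv)
qed

lemma mult_assoc: "(x \<cdot> y) \<cdot> z = x \<cdot> (y \<cdot> z)"
  using mult_assoc_dual[of y z x] by (simp add: inv_mult inv_inv)

lemma left_commute: "x \<cdot> (x\<acute> \<cdot> (y \<cdot> y\<acute>)) = y \<cdot> (y\<acute> \<cdot> (x \<cdot> x\<acute>))"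
proof -
  define p where "p = x \<cdot> x\<acute>"
  define r where "r = y \<cdot> y\<acute>"
  have self_inverse: "p\<acute> = p" "r\<acute> = r"
    by (simp_all add: p_def r_def inv_mult_inv)
  have "p \<cdot> r = r \<cdot> (p \<cdot> r)"
    using left_mult_commute[of x y r] by (simp add: p_def r_def mult_assoc inv_mult_inv_left)
  \<comment> \<open>Inverting p r gives r p, while r (p r) is its own inverse.\<close>
  then have "p \<cdot> r = r \<cdot> p"
    by (metis inv_mult mult_assoc self_inverse)
  then show ?thesis
    by (simp add: p_def r_def mult_assoc)
qed

text \<open>Idempotents are self-inverse, in particular a b and b a. Inverting a a' = (a b) (a a')
  gives a a' = (a a') (a b) = a b; similarly a' a = b a. Hence b = (b a) b = a' (a b) = a' (a a') =
  a'.\<close>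

lemma inv_unique:
  assumes "a \<cdot> (b \<cdot> a) = a" and "b \<cdot> (a \<cdot> b) = b"
  shows "b = a\<acute>"
proof -
  have idem_inv: "e\<acute> = e" if e: "e \<cdot> e = e" for e
  proof -
    have e': "e\<acute> \<cdot> e\<acute> = e\<acute>"
      using inv_mult[of e e] e by simp
    have "e\<acute> = e\<acute> \<cdot> (e \<cdot> (e \<cdot> e\<acute>))"
      by (metis e inv_mult_inv_left mult_assoc)
    also have "\<dots> = e \<cdot> (e\<acute> \<cdot> (e\<acute> \<cdot> e))"
      using left_commute[of "e\<acute>" e] by (simp add: inv_inv)
    also have "\<dots> = e"
      by (metis e' id1 mult_assoc)
    finally show ?thesis .
  qed
  have ab: "b\<acute> \<cdot> a\<acute> = a \<cdot> b"
    by (metis assms(1) idem_inv inv_mult mult_assoc)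
  have ba: "a\<acute> \<cdot> b\<acute> = b \<cdot> a"
    by (metis assms(1) idem_inv inv_mult mult_assoc)
  have "a \<cdot> a\<acute> = a \<cdot> b \<cdot> (a \<cdot> a\<acute>)"
    by (metis assms(1) mult_assoc)
  then have 1: "a \<cdot> a\<acute> = a \<cdot> b"
    by (metis ab id1 inv_mult inv_mult_inv mult_assoc)
  have "a\<acute> \<cdot> a = a\<acute> \<cdot> a \<cdot> (b \<cdot> a)"
    by (metis assms(1) mult_assoc)
  then have 2: "a\<acute> \<cdot> a = b \<cdot> a"
    by (metis ba id1 inv_inv inv_mult inv_mult_inv_left mult_assoc)
  show ?thesis
    by (metis 1 2 assms(2) inv_mult_inv_left mult_assoc)
qed

end

section \<open>Inverse semigroups satisfy the two identities\<close>

locale inverse_semigroup =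
  fixes mult :: "'a \<Rightarrow> 'a \<Rightarrow> 'a"  (infixl "\<cdot>" 70)
    and inv :: "'a \<Rightarrow> 'a"  ("_\<acute>" [1000] 1000)
  assumes assoc: "(x \<cdot> y) \<cdot> z = x \<cdot> (y \<cdot> z)"
    and mult_inv_mult: "x \<cdot> (x\<acute> \<cdot> x) = x"
    and inv_mult_inv: "x\<acute> \<cdot> (x \<cdot> x\<acute>) = x\<acute>"
    and inv_unique: "a \<cdot> (b \<cdot> a) = a \<Longrightarrow> b \<cdot> (a \<cdot> b) = b \<Longrightarrow> b = a\<acute>"
begin

lemma inv_inv: "x\<acute>\<acute> = x"
  by (metis inv_mult_inv inv_unique mult_inv_mult)

lemma idem_inv: "e \<cdot> e = e \<Longrightarrow> e\<acute> = e"
  by (metis inv_unique)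

text \<open>If x is the inverse of e f, then f x e is another one, so x = f x e. This makes x
  idempotent, hence self-inverse, and therefore equal to e f.\<close>

lemma idem_mult:
  assumes e: "e \<cdot> e = e" and f: "f \<cdot> f = f"
  shows "(e \<cdot> f) \<cdot> (e \<cdot> f) = e \<cdot> f"
proof -
  define x where "x = (e \<cdot> f)\<acute>"
  have efe: "e \<cdot> (e \<cdot> z) = e \<cdot> z" and fff: "f \<cdot> (f \<cdot> z) = f \<cdot> z" for z
    by (simp_all add: e f assoc[symmetric])
  have x1: "e \<cdot> (f \<cdot> (x \<cdot> (e \<cdot> f))) = e \<cdot> f"
    using mult_inv_mult[of "e \<cdot> f"] by (simp add: x_def assoc)
  have x2: "x \<cdot> (e \<cdot> (f \<cdot> x)) = x"
    using inv_mult_inv[of "e \<cdot> f"] by (simp add: x_def assoc)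
  have x2': "x \<cdot> (e \<cdot> (f \<cdot> (x \<cdot> z))) = x \<cdot> z" for z
    using arg_cong[OF x2, of "\<lambda>t. t \<cdot> z"] by (simp add: assoc)
  have "f \<cdot> (x \<cdot> e) = x"
    unfolding x_def
    by (rule inv_unique) (simp_all add: x_def[symmetric] assoc e f efe fff x1 x2')
  then have "x \<cdot> x = x"
    by (metis assoc x2')
  then show ?thesis
    using idem_inv[of x] by (simp add: x_def inv_inv)
qed

text \<open>As e f and f e are idempotent, f e is an inverse of e f; but the idempotent e f is its
  own inverse.\<close>

lemma idem_commute:
  assumes e: "e \<cdot> e = e" and f: "f \<cdot> f = f"
  shows "e \<cdot> f = f \<cdot> e"
proof -
  have "f \<cdot> e = (e \<cdot> f)\<acute>"
  proof (rule inv_unique)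
    show "e \<cdot> f \<cdot> (f \<cdot> e \<cdot> (e \<cdot> f)) = e \<cdot> f"
      using idem_mult[OF e f] by (metis assoc e f)
    show "f \<cdot> e \<cdot> (e \<cdot> f \<cdot> (f \<cdot> e)) = f \<cdot> e"
      using idem_mult[OF f e] by (metis assoc e f)
  qed
  then show ?thesis
    using idem_inv[OF idem_mult[OF e f]] by simp
qed

lemma range_commute: "x \<cdot> x\<acute> \<cdot> (y \<cdot> y\<acute>) = y \<cdot> y\<acute> \<cdot> (x \<cdot> x\<acute>)"
  by (rule idem_commute) (simp_all add: assoc inv_mult_inv)

text \<open>Interchanging the idempotents y y' and x' x shows that y' x' is an inverse of x
  y.\<close>

lemma inv_mult: "(x \<cdot> y)\<acute> = y\<acute> \<cdot> x\<acute>"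
proof -
  have comm: "y \<cdot> y\<acute> \<cdot> (x\<acute> \<cdot> x) = x\<acute> \<cdot> x \<cdot> (y \<cdot> y\<acute>)"
    using range_commute[of y "x\<acute>"] by (simp add: inv_inv)
  have "x \<cdot> (y \<cdot> y\<acute> \<cdot> (x\<acute> \<cdot> x)) \<cdot> y = x \<cdot> y"
    unfolding comm by (metis assoc mult_inv_mult)
  moreover have "y\<acute> \<cdot> (x\<acute> \<cdot> x \<cdot> (y \<cdot> y\<acute>)) \<cdot> x\<acute> = y\<acute> \<cdot> x\<acute>"
    unfolding comm[symmetric] by (metis assoc inv_mult_inv)
  ultimately show ?thesis
    by (intro inv_unique[symmetric]) (simp_all add: assoc)
qed

lemma id2: "x \<cdot> (x\<acute> \<cdot> (y \<cdot> (y\<acute> \<cdot> ((z \<cdot> u)\<acute> \<cdot> w\<acute>)\<acute>))) =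
    y \<cdot> (y\<acute> \<cdot> (x \<cdot> (x\<acute> \<cdot> ((w \<cdot> z) \<cdot> u))))"
proof -
  have "((z \<cdot> u)\<acute> \<cdot> w\<acute>)\<acute> = (w \<cdot> z) \<cdot> u"
    by (simp add: inv_mult inv_inv assoc)
  then show ?thesis
    using range_commute[of x y] by (metis assoc)
qed

end

section \<open>Extending an algebra from a subset to the whole type\<close>

definition orth_mult :: "'a set \<Rightarrow> 'a \<Rightarrow> ('a \<Rightarrow> 'a \<Rightarrow> 'a) \<Rightarrow> 'a \<Rightarrow> 'a \<Rightarrow> 'a" where
  "orth_mult S zero f x y = (if x \<in> S \<and> y \<in> S then f x y else if x = y then x else zero)"

definition orth_inv :: "'a set \<Rightarrow> ('a \<Rightarrow> 'a) \<Rightarrow> 'a \<Rightarrow> 'a" where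
  "orth_inv S g x = (if x \<in> S then g x else x)"

context
  fixes S :: "'a set" and f g zero
  assumes alg: "algebra_2_1 S f g" and zero: "zero \<notin> S"
begin

lemma closed: "x \<in> S \<Longrightarrow> y \<in> S \<Longrightarrow> f x y \<in> S" "x \<in> S \<Longrightarrow> g x \<in> S"
  using alg by (simp_all add: algebra_2_1_def)

lemma mem_neq: "x \<in> S \<Longrightarrow> y \<notin> S \<Longrightarrow> x \<noteq> y" "x \<in> S \<Longrightarrow> y \<notin> S \<Longrightarrow> y \<noteq> x"
  by auto

lemma identity1_orth_iff:
  "identity1 UNIV (orth_mult S zero f) (orth_inv S g) \<longleftrightarrow> identity1 S f g"
  by (auto simp: identity1_def orth_mult_def orth_inv_def closed)

lemma identity2_orth_iff:
  "identity2 UNIV (orth_mult S zero f) (orth_inv S g) \<longleftrightarrow> identity2 S f g"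
proof
  assume id2: "identity2 UNIV (orth_mult S zero f) (orth_inv S g)"
  show "identity2 S f g"
    unfolding identity2_def
  proof (intro ballI)
    fix x y z u w assume "x \<in> S" "y \<in> S" "z \<in> S" "u \<in> S" "w \<in> S"
    with id2[unfolded identity2_def, rule_format, of x y z u w]
    show "f x (f (g x) (f y (f (g y) (g (f (g (f z u)) (g w)))))) =
          f y (f (g y) (f x (f (g x) (f (f w z) u))))"
      by (simp add: orth_mult_def orth_inv_def closed)
  qed
next
  assume "identity2 S f g"
  then show "identity2 UNIV (orth_mult S zero f) (orth_inv S g)"
    unfolding identity2_def
  proof (intro ballI)
    fix x y z u w :: 'a
    let ?m = "orth_mult S zero f" and ?v = "orth_inv S g"
    assume id2: "\<forall>x\<in>S. \<forall>y\<in>S. \<forall>z\<in>S. \<forall>u\<in>S. \<forall>w\<in>S.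
       f x (f (g x) (f y (f (g y) (g (f (g (f z u)) (g w)))))) =
       f y (f (g y) (f x (f (g x) (f (f w z) u))))"
    \<comment> \<open>This is L_x t in the extended algebra. Once x or t lies outside S, it is
      nonzero only for x = t.\<close>
    have L: "?m x (?m (?v x) t) =
        (if x \<in> S \<and> t \<in> S then f x (f (g x) t) else if x = t then x else zero)" for x t
      by (auto simp: zero orth_mult_def orth_inv_def closed)
    show "?m x (?m (?v x) (?m y (?m (?v y) (?v (?m (?v (?m z u)) (?v w)))))) =
        ?m y (?m (?v y) (?m x (?m (?v x) (?m (?m w z) u))))"
    proof (cases "z \<in> S \<and> u \<in> S \<and> w \<in> S")
      case True
      then have "?v (?m (?v (?m z u)) (?v w)) = g (f (g (f z u)) (g w))"
        and "?m (?m w z) u = f (f w z) u"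
        by (simp_all add: orth_mult_def orth_inv_def closed)
      with True id2 show ?thesis
        by (auto simp: zero L closed)
    next
      case False
      \<comment> \<open>A triple product with a factor outside S is \<open>zero\<close> unless all
        three factors coincide. Both inner terms are thus the same element t outside S, and L_x (L_y
        t) is t for x = y = t and \<open>zero\<close> otherwise.\<close>
      then have "?v (?m (?v (?m z u)) (?v w)) = (if w = z \<and> z = u then u else zero)"
        by (cases "z \<in> S"; cases "u \<in> S"; cases "w \<in> S")
          (auto simp: zero orth_mult_def orth_inv_def closed)
      moreover from False have "?m (?m w z) u = (if w = z \<and> z = u then u else zero)"
        by (cases "z \<in> S"; cases "u \<in> S"; cases "w \<in> S")
          (auto simp: zero orth_mult_def orth_inv_def closed)
      moreover from False have "(if w = z \<and> z = u then u else zero) \<notin> S"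
        using zero by auto
      ultimately show ?thesis
        by (auto simp: zero L closed)
    qed
  qed
qed

lemma semigroup_orth_iff: "semigroup_on UNIV (orth_mult S zero f) \<longleftrightarrow> semigroup_on S f"
proof
  assume semi: "semigroup_on UNIV (orth_mult S zero f)"
  show "semigroup_on S f"
    unfolding semigroup_on_def
  proof (intro conjI ballI)
    fix x y z assume "x \<in> S" "y \<in> S" "z \<in> S"
    with semi[unfolded semigroup_on_def, THEN conjunct2, rule_format, of x y z]
    show "f (f x y) z = f x (f y z)"
      by (simp add: orth_mult_def closed)
  qed (rule closed)
next
  assume "semigroup_on S f"
  then show "semigroup_on UNIV (orth_mult S zero f)"
    unfolding semigroup_on_def
  proof (intro conjI ballI UNIV_I)
    fix x y z
    assume semi: "(\<forall>x\<in>S. \<forall>y\<in>S. f x y \<in> S) \<and>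
      (\<forall>x\<in>S. \<forall>y\<in>S. \<forall>z\<in>S. f (f x y) z = f x (f y z))"
    let ?m = "orth_mult S zero f"
    show "?m (?m x y) z = ?m x (?m y z)"
    proof (cases "x \<in> S \<and> y \<in> S \<and> z \<in> S")
      case True
      with semi show ?thesis
        by (simp add: orth_mult_def)
    next
      case False
      then show ?thesis
        by (cases "x \<in> S"; cases "y \<in> S"; cases "z \<in> S")
          (simp_all add: orth_mult_def closed mem_neq zero)
    qed
  qed
qed

lemma natural_inversion_orth_iff:
  "natural_inversion UNIV (orth_mult S zero f) (orth_inv S g) \<longleftrightarrow> natural_inversion S f g"
proof -
  \<comment> \<open>For a in S and b outside, (a b) a is \<open>zero\<close>, which differs from a.
    For a outside S and b distinct from a, (a b) a and (b a) b are both \<open>zero\<close>, and a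
    and b cannot both be \<open>zero\<close>.\<close>
  have "is_inverse_of UNIV (orth_mult S zero f) b a \<longleftrightarrow>
      (if a \<in> S then is_inverse_of S f b a else b = a)" for a b
    by (auto simp: zero is_inverse_of_def orth_mult_def closed split: if_splits)
  then show ?thesis
    by (auto simp: natural_inversion_def orth_inv_def closed)
qed

end

section \<open>The equivalence, first on the whole type and then on any carrier\<close>

lemma identities_iff_inverse_semigroup_UNIV:
  fixes f :: "'a \<Rightarrow> 'a \<Rightarrow> 'a"
  shows "identity1 UNIV f g \<and> identity2 UNIV f g \<longleftrightarrow>
    semigroup_on UNIV f \<and> natural_inversion UNIV f g"
proof
  assume "identity1 UNIV f g \<and> identity2 UNIV f g"
  then interpret two_identities f g
    by unfold_locales (simp_all add: identity1_def identity2_def)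
  show "semigroup_on UNIV f \<and> natural_inversion UNIV f g"
    using inv_unique
    by (auto simp: semigroup_on_def natural_inversion_def is_inverse_of_def
        mult_assoc id1 inv_mult_inv_left)
next
  assume "semigroup_on UNIV f \<and> natural_inversion UNIV f g"
  then interpret inverse_semigroup f g
    by unfold_locales (auto simp: semigroup_on_def natural_inversion_def is_inverse_of_def)
  show "identity1 UNIV f g \<and> identity2 UNIV f g"
    by (simp add: identity1_def identity2_def mult_inv_mult id2)
qed

lemma identities_iff_inverse_semigroup:
  fixes S :: "'a set"
  assumes "algebra_2_1 S f g"
  shows "identity1 S f g \<and> identity2 S f g \<longleftrightarrow>
    inverse_semigroup_on S f \<and> natural_inversion S f g"
proof -
  \<comment> \<open>Under \<open>natural_inversion\<close>, which gives existence and uniqueness of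
    inverses, \<open>inverse_semigroup_on\<close> amounts to \<open>semigroup_on\<close>.\<close>
  have "identity1 S f g \<and> identity2 S f g \<longleftrightarrow> semigroup_on S f \<and> natural_inversion S f g"
  proof (cases "S = UNIV")
    case True
    then show ?thesis
      by (simp add: identities_iff_inverse_semigroup_UNIV)
  next
    case False
    then obtain zero where "zero \<notin> S"
      by blast
    with assms show ?thesis
      using identities_iff_inverse_semigroup_UNIV[of "orth_mult S zero f" "orth_inv S g"]
      by (simp add: identity1_orth_iff identity2_orth_iff semigroup_orth_iff natural_inversion_orth_iff)
  qed
  then show ?thesis
    by (auto simp: inverse_semigroup_on_def natural_inversion_def)
qed

section \<open>Independence of the two identities\<close>

lemma left_zero_band_separates:
  "\<exists>(S :: nat set) mult inv. algebra_2_1 S mult inv \<and> identity1 S mult inv \<and> \<not> identity2 S mult inv"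
  \<comment> \<open>Every product equals its leftmost factor, so the second identity would say x =
    y.\<close>
  by (intro exI[of _ "{0, 1}"] exI[of _ "\<lambda>x y. x"] exI[of _ "\<lambda>x. x"])
    (auto simp: algebra_2_1_def identity1_def identity2_def)

lemma null_semigroup_separates:
  "\<exists>(S :: nat set) mult inv. algebra_2_1 S mult inv \<and> identity2 S mult inv \<and> \<not> identity1 S mult inv"
  \<comment> \<open>Both sides of the second identity are products and hence 0; the first identity
    fails at x = 1.\<close>
  by (intro exI[of _ "{0, 1}"] exI[of _ "\<lambda>x y. 0"] exI[of _ "\<lambda>x. x"])
    (auto simp: algebra_2_1_def identity1_def identity2_def)

theorem mainTheorem1:
  shows "(\<forall>(S :: 'a set) mult inv. algebra_2_1 S mult inv \<longrightarrow>
            ((identity1 S mult inv \<and> identity2 S mult inv) \<longleftrightarrow>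
             (inverse_semigroup_on S mult \<and> natural_inversion S mult inv)))
       \<and> (\<exists>(S :: nat set) mult inv. algebra_2_1 S mult inv \<and>
            identity1 S mult inv \<and> \<not> identity2 S mult inv)
       \<and> (\<exists>(S :: nat set) mult inv. algebra_2_1 S mult inv \<and>
            identity2 S mult inv \<and> \<not> identity1 S mult inv)"
  using identities_iff_inverse_semigroup left_zero_band_separates null_semigroup_separates
  by blast

end
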